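(* There exists an absolute constant $c>0$ such that for every integer $N\ge 2$, $$\int_0^1\left|\sum_{p\le N}\chi_3(p)\, e(p\alpha)\right|\,d\alpha\;\ge\; c\,\frac{N^{1/4}}{\log N},$$ where the sum is over primes $p\le N$ and $\chi_3$ is the non-principal Dirichlet character modulo three.
   Context: For real $x$, $e(x)=e^{2\pi i x}$. The character $\chi_3$ is given by $\chi_3(n)=0$ if $n\equiv0\pmod 3$, $\chi_3(n)=1$ if $n\equiv1\pmod 3$, and $\chi_3(n)=-1$ if $n\equiv2\pmod 3$. *)

theory Defs
  imports "HOL-Analysis.Analysis" "HOL-Computational_Algebra.Primes"
begin

definition unit_exp :: "real \<Rightarrow> complex" where
  "unit_exp x = exp (2 * complex_of_real pi * \<i> * complex_of_real x)"

definition chi3 :: "int \<Rightarrow> complex" where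
  "chi3 n = (if n mod 3 = 0 then 0 else if n mod 3 = 1 then 1 else -1)"

end

(*
  Write S(x) for the exponential sum. At the rational 1/3 the summand chi3(p) e(p/3) has imaginary
  part sqrt 3 / 2 for every prime p other than 3, so |S(1/3 + y)| is at least half the number of
  these primes as long as |y| <= 1/(12 N). For a prime q, orthogonality of the additive characters
  mod q gives sum_{0 < a < q} S(1/3 + a/q + y) = -S(1/3 + y) + O(q), since only the term p = q
  survives in the complete sum. The points 1/3 + a/q for primes q <= sqrt N are separated by at
  least 1/N, so every such q contributes a further >> pi(N)/N to the integral on disjoint intervals.
  Chebyshev's lower bound for pi, applied at N and at sqrt N, yields >> sqrt N / (log N)^2, more than
  is needed for large N; for the finitely many other N it is enough that S does not vanish at 1/3.
*)

theory Submission
  imports Defs "HOL-Number_Theory.Prime_Powers" "HOL-Real_Asymp.Real_Asymp"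
begin

subsection \<open>A Chebyshev-type lower bound\<close>

text \<open>Expand each \<open>ln k\<close> as the sum of \<open>mangoldt d\<close> over the
  divisors \<open>d\<close> of \<open>k\<close> and swap the sums: \<open>n div d\<close> counts the
  multiples of \<open>d\<close> up to \<open>n\<close>. The free limit \<open>m\<close> allows
  formulas for different factorials to be combined over one range of \<open>d\<close>.\<close>

lemma ln_fact_eq_sum_mangoldt:
  assumes "n \<le> m"
  shows "ln (fact n :: real) = (\<Sum>d=1..m. mangoldt d * real (n div d))"
proof -
  have "ln (fact n :: real) = (\<Sum>k=1..n. ln (real k))"
    unfolding fact_prod of_nat_prod by (subst ln_prod) auto
  also have "\<dots> = (\<Sum>k=1..n. \<Sum>d | d \<in> {1..m} \<and> d dvd k. mangoldt d)"
  proof (rule sum.cong)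
    fix k assume k: "k \<in> {1..n}"
    have "{d. d \<in> {1..m} \<and> d dvd k} = {d. d dvd k}"
      using k assms by (auto dest: dvd_imp_le simp: Suc_le_eq intro: Nat.gr0I)
    then show "ln (real k) = (\<Sum>d | d \<in> {1..m} \<and> d dvd k. mangoldt d)"
      using mangoldt_sum[of k, where 'a = real] k by simp
  qed simp
  also have "\<dots> = (\<Sum>d=1..m. \<Sum>k | k \<in> {1..n} \<and> d dvd k. mangoldt d)"
    by (rule sum.swap_restrict) auto
  also have "\<dots> = (\<Sum>d=1..m. mangoldt d * real (n div d))"
  proof (rule sum.cong)
    fix d assume d: "d \<in> {1..m}"
    have "{k. k \<in> {1..n} \<and> d dvd k} = (\<lambda>j. d * j) ` {1..n div d}"
      using d by (auto simp: less_eq_div_iff_mult_less_eq mult.commute elim!: dvdE)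
    moreover have "inj_on (\<lambda>j. d * j) {1..n div d}"
      using d by (auto simp: inj_on_def)
    ultimately have "card {k. k \<in> {1..n} \<and> d dvd k} = n div d"
      by (simp add: card_image)
    then show "(\<Sum>k | k \<in> {1..n} \<and> d dvd k. mangoldt d) = mangoldt d * real (n div d)"
      by simp
  qed simp
  finally show ?thesis .
qed

text \<open>A prime \<open>p\<close> contributes \<open>ln p\<close> once for every power
  \<open>p ^ k \<le> n\<close>. There are at most \<open>log p n\<close> such powers, so its total
  share is at most \<open>ln n\<close>.\<close>

lemma sum_mangoldt_le:
  assumes "n > 0"
  shows "(\<Sum>d=1..n. mangoldt d) \<le> real (card {p. prime p \<and> p \<le> n}) * ln (real n)"
proof -
  let ?P = "{p. prime p \<and> p \<le> n}"
  let ?S = "{d\<in>{1..n}. primepow d}"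
  have "(\<Sum>d=1..n. mangoldt d) = (\<Sum>d\<in>?S. ln (real (aprimedivisor d)))"
    by (rule sum.mono_neutral_cong_right) (auto simp: mangoldt_def)
  also have "\<dots> = (\<Sum>p\<in>?P. \<Sum>d | d \<in> ?S \<and> aprimedivisor d = p. ln (real (aprimedivisor d)))"
  proof (rule sum.group [symmetric])
    show "aprimedivisor ` ?S \<subseteq> ?P"
    proof clarsimp
      fix d assume d: "primepow d" "Suc 0 \<le> d" "d \<le> n"
      then have "d > 1" using primepow_gt_Suc_0[of d] by simp
      then show "prime (aprimedivisor d) \<and> aprimedivisor d \<le> n"
        using aprimedivisor_le_nat[of d] d prime_aprimedivisor'[of d] by auto
    qed
  qed auto
  also have "\<dots> \<le> (\<Sum>p\<in>?P. ln (real n))"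
  proof (rule sum_mono)
    fix p assume p: "p \<in> ?P"
    then have p1: "p > 1" using prime_gt_1_nat by auto
    define K where "K = nat \<lfloor>log p n\<rfloor>"
    have log0: "0 \<le> log p n" using p1 assms by simp
    have "{d. d \<in> ?S \<and> aprimedivisor d = p} \<subseteq> (\<lambda>k. p ^ k) ` {1..K}"
    proof
      fix d assume "d \<in> {d. d \<in> ?S \<and> aprimedivisor d = p}"
      then have d: "d \<in> {1..n}" "primepow d" "aprimedivisor d = p" by auto
      then obtain q k where qk: "prime q" "k > 0" "d = q ^ k"
        by (auto simp: primepow_def)
      then have "q = p" using d by (simp add: aprimedivisor_prime_power)
      with qk have dk: "d = p ^ k" by simp
      with d have "real p ^ k \<le> real n" by (metis atLeastAtMost_iff of_nat_le_iff of_nat_power)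
      then have "real k \<le> log p n"
        using p1 assms by (simp add: le_log_iff powr_realpow)
      then have "k \<le> K" unfolding K_def by (simp add: le_nat_floor)
      with dk qk(2) show "d \<in> (\<lambda>k. p ^ k) ` {1..K}" by simp
    qed
    then have "card {d. d \<in> ?S \<and> aprimedivisor d = p} \<le> K"
      using surj_card_le[of "{1..K}"] by fastforce
    then have "real (card {d. d \<in> ?S \<and> aprimedivisor d = p}) \<le> log p n"
      unfolding K_def using log0 by linarith
    then have "real (card {d. d \<in> ?S \<and> aprimedivisor d = p}) * ln p \<le> log p n * ln p"
      using p1 by (intro mult_right_mono) auto
    also have "\<dots> = ln n" using p1 by (simp add: log_def)
    finally show "(\<Sum>d | d \<in> ?S \<and> aprimedivisor d = p. ln (real (aprimedivisor d))) \<le> ln n"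
      by simp
  qed
  finally show ?thesis by simp
qed

text \<open>In \<open>(2n)! / (n!)^2\<close> the weight of \<open>mangoldt d\<close> is
  \<open>2 * n div d - 2 * (n div d)\<close>, an integer below 2.\<close>

lemma ln_central_binomial_le:
  "ln (real ((2 * n) choose n)) \<le> (\<Sum>d=1..2 * n. mangoldt d)"
proof -
  have "real ((2 * n) choose n) = fact (2 * n) / (fact n * fact n)"
    using binomial_fact[of n "2 * n", where 'a = real] by (simp add: mult_2)
  then have "ln (real ((2 * n) choose n)) = ln (fact (2 * n) :: real) - 2 * ln (fact n :: real)"
    by (simp add: ln_div ln_mult)
  also have "\<dots> = (\<Sum>d=1..2 * n. mangoldt d * (real (2 * n div d) - 2 * real (n div d)))"
    by (simp add: ln_fact_eq_sum_mangoldt[of _ "2 * n"] sum_distrib_left sum_subtractf algebra_simps)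
  also have "\<dots> \<le> (\<Sum>d=1..2 * n. mangoldt d * 1)"
  proof (intro sum_mono mult_left_mono mangoldt_nonneg)
    fix d assume d: "d \<in> {1..2 * n}"
    have "2 * n div d < 2 * (n div d) + 2"
    proof -
      have "2 * n = d * (2 * (n div d)) + 2 * (n mod d)"
        using mult_div_mod_eq[of d n] by (metis add_mult_distrib2 mult.left_commute)
      also have "\<dots> < d * (2 * (n div d) + 2)" using d by (simp add: distrib_left)
      finally show ?thesis using d by (simp add: div_less_iff_less_mult mult.commute)
    qed
    then show "real (2 * n div d) - 2 * real (n div d) \<le> 1" by linarith
  qed
  finally show ?thesis by simp
qed

text \<open>Chebyshev's argument: the central binomial coefficient is at least
  \<open>4 ^ n / (2 * n)\<close>, while its logarithm is bounded above by a sum of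
  \<open>mangoldt\<close>, hence by the prime count.\<close>

lemma card_primes_ln_ge:
  assumes "N \<ge> 2"
  shows "real (card {p. prime p \<and> p \<le> N}) * ln (real N) \<ge> (real N - 1) * ln 2 - ln (real N)"
proof -
  define n where "n = N div 2"
  have n: "n > 0" "2 * n \<le> N" "N \<le> 2 * n + 1" using assms unfolding n_def by auto
  \<comment> \<open>The main term uses \<open>N - 1 \<le> 2 * n\<close>, the logarithm uses
    \<open>2 * n \<le> N\<close>; this covers both parities of \<open>N\<close>.\<close>
  have "(real N - 1) * ln 2 - ln (real N) \<le> (2 * real n) * ln 2 - ln (2 * real n)"
    using n by (intro diff_mono mult_right_mono) (auto simp del: ln_le_cancel_iff intro!: ln_mono)
  also have "\<dots> = ln (4 ^ n / (2 * real n))"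
    using n ln_realpow[of 4 n] ln_realpow[of 2 2] by (simp add: ln_div)
  also have "\<dots> \<le> ln (real ((2 * n) choose n))"
    using central_binomial_lower_bound[of n] n by (intro ln_mono) auto
  also have "\<dots> \<le> (\<Sum>d=1..2 * n. mangoldt d)" by (rule ln_central_binomial_le)
  also have "\<dots> \<le> (\<Sum>d=1..N. mangoldt d)"
    using n by (intro sum_mono2) (auto intro: mangoldt_nonneg)
  also have "\<dots> \<le> real (card {p. prime p \<and> p \<le> N}) * ln (real N)"
    using assms by (intro sum_mangoldt_le) auto
  finally show ?thesis .
qed

subsection \<open>Exponentials and intervals around fractions with prime denominator\<close>

lemma unit_exp_eq_cis: "unit_exp x = cis (2 * pi * x)"
  by (simp add: unit_exp_def cis_conv_exp mult_ac)

lemma norm_unit_exp [simp]: "norm (unit_exp x) = 1"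
  by (simp add: unit_exp_eq_cis)

lemma unit_exp_add: "unit_exp (x + y) = unit_exp x * unit_exp y"
  by (simp add: unit_exp_eq_cis cis_mult distrib_left)

lemma unit_exp_of_nat [simp]: "unit_exp (real n) = 1"
  by (simp add: unit_exp_eq_cis complex_eq_iff)

lemma unit_exp_power: "unit_exp x ^ n = unit_exp (real n * x)"
  by (simp only: unit_exp_eq_cis Complex.DeMoivre mult_ac)

lemma continuous_on_unit_exp [continuous_intros]:
  "continuous_on S f \<Longrightarrow> continuous_on S (\<lambda>x. unit_exp (f x))"
  unfolding unit_exp_def by (intro continuous_intros)

text \<open>A geometric sum over powers of the \<open>q\<close>-th root of unity \<open>?w\<close>,
  which equals 1 exactly when \<open>q dvd n\<close>.\<close>

lemma sum_unit_exp_fractions: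
  assumes "q > 0"
  shows "(\<Sum>a<q. unit_exp (real n * (real a / real q))) = (if q dvd n then of_nat q else 0)"
proof -
  let ?w = "unit_exp (real n / real q)"
  have eq: "unit_exp (real n * (real a / real q)) = ?w ^ a" for a
    by (simp only: unit_exp_power) (simp add: mult_ac)
  have "?w ^ q = 1" using assms by (simp add: unit_exp_power)
  moreover have "?w = 1 \<longleftrightarrow> q dvd n"
  proof
    assume "?w = 1"
    then have "cos (2 * pi * (real n / real q)) = 1"
      by (simp add: unit_exp_eq_cis complex_eq_iff)
    then obtain k :: int where "2 * pi * (real n / real q) = real_of_int k * 2 * pi"
      unfolding cos_one_2pi_int by auto
    then have "real n = real_of_int k * real q" using assms by (simp add: field_simps)
    then have "int n = k * int q" by (metis of_int_eq_iff of_int_mult of_int_of_nat_eq)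
    then show "q dvd n" by (metis dvd_triv_right int_dvd_int_iff)
  next
    assume "q dvd n"
    then show "?w = 1" using assms by auto
  qed
  moreover have "(1 - ?w) * (\<Sum>a<q. ?w ^ a) = 1 - ?w ^ q"
    by (rule one_diff_power_eq [symmetric])
  ultimately show ?thesis unfolding eq by auto
qed

section \<open>Disjoint intervals inside one period\<close>

lemma integral_periodic_shift:
  fixes g :: "real \<Rightarrow> real"
  assumes cont: "continuous_on UNIV g" and per: "\<And>x. g (x + 1) = g x"
    and t: "0 \<le> t" "t \<le> 1"
  shows "integral {0..1} (\<lambda>x. g (t + x)) = integral {0..1} g"
proof -
  have int: "g integrable_on {a..b}" for a b
    by (rule integrable_continuous_real) (rule continuous_on_subset[OF cont], simp)
  have "integral {0..1} (\<lambda>x. g (t + x)) = integral {t..1 + t} g"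
    using integral_shift_Icc_real[of 0 1 g t] by (simp add: o_def add.commute)
  also have "\<dots> = integral {t..1} g + integral {1..1 + t} g"
    by (intro Henstock_Kurzweil_Integration.integral_combine [symmetric]) (use t int in auto)
  also have "integral {1..1 + t} g = integral {0..t} g"
    using integral_shift_Icc_real[of 0 t g 1] per by (simp add: o_def add.commute)
  also have "integral {t..1} g + integral {0..t} g = integral {0..1} g"
    using t int Henstock_Kurzweil_Integration.integral_combine[of 0 t 1 g] by auto
  finally show ?thesis .
qed

text \<open>The numerator \<open>a * q - b * p\<close> of the difference is a nonzero integer: if it
  vanished, \<open>p\<close> would divide \<open>q\<close> because \<open>0 < a < p\<close>, so
  \<open>p = q\<close> and then \<open>a = b\<close>.\<close>

lemma prime_fractions_dist:
  fixes p q a b :: nat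
  assumes "prime p" "prime q" "0 < a" "a < p" "0 < b" "b < q" "(p, a) \<noteq> (q, b)"
  shows "\<bar>real a / real p - real b / real q\<bar> \<ge> 1 / (real p * real q)"
proof -
  have pos: "p > 0" "q > 0" using assms by auto
  have "a * q \<noteq> b * p"
  proof
    assume eq: "a * q = b * p"
    then have "p dvd a * q" by simp
    then have "p dvd q" using assms by (auto simp: prime_dvd_mult_iff dest: dvd_imp_le)
    then have "p = q" using assms by (simp add: primes_dvd_imp_eq)
    with eq assms show False by auto
  qed
  then have "\<bar>int (a * q) - int (b * p)\<bar> \<ge> 1" by linarith
  then have "real_of_int \<bar>int (a * q) - int (b * p)\<bar> \<ge> 1" by (simp only: of_int_1_le_iff)
  then have "\<bar>real a * real q - real b * real p\<bar> \<ge> 1" by simp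
  moreover have "real a / real p - real b / real q = (real a * real q - real b * real p) / (real p * real q)"
    using pos by (simp add: field_simps)
  ultimately show ?thesis using pos by (simp add: divide_right_mono)
qed

text \<open>Distinct centres are at least \<open>1 / Q\<^sup>2\<close> apart, more than the interval
  length \<open>2 * d\<close>, so the intervals are disjoint and a nonnegative integrand loses
  nothing but the gaps.\<close>

lemma sum_integral_prime_fractions_le:
  fixes g :: "real \<Rightarrow> real"
  assumes cont: "continuous_on UNIV g" and nonneg: "\<And>x. g x \<ge> 0"
    and P: "finite P" "\<And>q. q \<in> P \<Longrightarrow> prime q \<and> real q \<le> Q"
    and d: "0 \<le> d" "2 * d * Q\<^sup>2 < 1"
  shows "(\<Sum>q\<in>P. \<Sum>a=1..<q. integral {-d..d} (\<lambda>y. g (real a / real q + y))) \<le> integral {0..1} g"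
proof -
  define I where "I = Sigma P (\<lambda>q. {1..<q})"
  define T where "T = (\<lambda>(q::nat, a::nat). {real a / real q - d..real a / real q + d})"
  have int: "g integrable_on {a..b}" for a b
    by (rule integrable_continuous_real) (rule continuous_on_subset[OF cont], simp)
  have sep: "2 * d < 1 / (real p * real q)" if "p \<in> P" "q \<in> P" for p q
  proof -
    have pq: "0 < real p * real q" "real p * real q \<le> Q\<^sup>2"
      using P(2)[OF that(1)] P(2)[OF that(2)]
      by (auto simp: prime_gt_0_nat power2_eq_square intro!: mult_mono)
    then have "2 * d * (real p * real q) \<le> 2 * d * Q\<^sup>2" using d by (intro mult_left_mono) auto
    then show ?thesis using d pq by (simp add: field_simps)
  qed
  have "(g has_integral (\<Sum>i\<in>I. integral (T i) g)) (\<Union>i\<in>I. T i)"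
  proof (rule has_integral_UN)
    show "finite I" unfolding I_def using P by auto
    show "(g has_integral integral (T i) g) (T i)" for i
      using int by (auto simp: T_def split: prod.split)
    show "pairwise (\<lambda>i i'. negligible (T i \<inter> T i')) I"
    proof (rule pairwiseI)
      fix i j assume ij: "i \<in> I" "j \<in> I" "i \<noteq> j"
      obtain p a q b where pq: "i = (p, a)" "j = (q, b)" by (cases i; cases j)
      have "\<bar>real a / real p - real b / real q\<bar> \<ge> 1 / (real p * real q)"
        using ij P(2) unfolding pq I_def by (intro prime_fractions_dist) auto
      moreover have "2 * d < 1 / (real p * real q)"
        using ij by (intro sep) (auto simp: pq I_def)
      ultimately have "T i \<inter> T j = {}" unfolding pq T_def by auto
      then show "negligible (T i \<inter> T j)" by simp
    qed
  qed
  moreover have "(\<Union>i\<in>I. T i) \<subseteq> {0..1}"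
  proof (rule UN_least)
    fix i assume "i \<in> I"
    then obtain q a where qa: "i = (q, a)" "q \<in> P" "1 \<le> a" "a < q" by (auto simp: I_def)
    have q: "real q \<ge> 1" using qa by simp
    \<comment> \<open>Taking both primes equal to \<open>q\<close> in \<open>sep\<close> bounds
      \<open>d\<close> by \<open>1 / q\<close>, the least distance of a centre from 0 or 1.\<close>
    have "d \<le> 2 * d * real q" using mult_left_mono[OF q, of d] d by auto
    also have "\<dots> \<le> 1 / real q" using sep[OF qa(2) qa(2)] q by (simp add: field_simps)
    finally have d1: "d \<le> 1 / real q" .
    have "1 / real q \<le> real a / real q" using qa q by (simp add: divide_right_mono)
    moreover have "real a / real q + 1 / real q \<le> 1"
      using qa q by (simp add: field_simps)
    ultimately show "T i \<subseteq> {0..1}" using d1 unfolding T_def qa by auto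
  qed
  ultimately have "(\<Sum>i\<in>I. integral (T i) g) \<le> integral {0..1} g"
    using has_integral_subset_le[of "\<Union>i\<in>I. T i" "{0..1}" g] int[of 0 1] nonneg
    by (auto simp: integrable_integral)
  moreover have "integral {-d..d} (\<lambda>y. g (real a / real q + y)) = integral (T (q, a)) g" for q a
    using integral_shift_Icc_real[of "-d" d g "real a / real q"]
    by (simp add: T_def o_def add.commute)
  ultimately show ?thesis unfolding I_def using P
    by (simp add: sum.Sigma case_prod_unfold)
qed

subsection \<open>The exponential sum over primes twisted by the character mod 3\<close>

lemma sin_ge_half:
  assumes "pi / 6 \<le> x" "x \<le> 5 * pi / 6"
  shows "sin x \<ge> 1 / 2"
proof (cases "x \<le> pi / 2")
  case True
  then have "sin (pi / 6) \<le> sin x" using assms by (intro sin_monotone_2pi_le) auto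
  then show ?thesis by (simp add: sin_30)
next
  case False
  then have "sin (pi / 6) \<le> sin (pi - x)" using assms by (intro sin_monotone_2pi_le) auto
  then show ?thesis by (simp add: sin_30)
qed

text \<open>At \<open>y = 0\<close> the sign of \<open>chi3\<close> matches that of
  \<open>sin (2 * pi * n / 3)\<close>, giving \<open>sqrt 3 / 2\<close>. The perturbation turns the
  angle by at most \<open>pi / 6\<close>, which keeps it, up to the sign, between
  \<open>pi / 6\<close> and \<open>5 * pi / 6\<close>.\<close>

lemma Im_chi3_unit_exp_ge:
  assumes "n mod 3 \<noteq> 0" and "\<bar>real n * y\<bar> \<le> 1 / 12"
  shows "Im (chi3 (int n) * unit_exp (real n * (1 / 3 + y))) \<ge> 1 / 2"
proof -
  define s where "s = 2 * pi * (real n * y)"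
  have "2 * pi * \<bar>real n * y\<bar> \<le> 2 * pi * (1 / 12)" using assms by (intro mult_left_mono) auto
  then have s: "\<bar>s\<bar> \<le> pi / 6" unfolding s_def by (simp add: abs_mult)
  have n: "real n = 3 * real (n div 3) + real (n mod 3)"
    by (metis mult_div_mod_eq of_nat_add of_nat_mult of_nat_numeral)
  have eq: "Im (unit_exp (real n * (1 / 3 + y))) = sin (2 * pi / 3 * real (n mod 3) + s)"
  proof -
    have "real n * (1 / 3 + y) = real (n div 3) + (real (n mod 3) / 3 + real n * y)"
      using n by (simp add: field_simps)
    then have "unit_exp (real n * (1 / 3 + y)) = unit_exp (real (n mod 3) / 3 + real n * y)"
      by (simp only: unit_exp_add[of "real (n div 3)"] unit_exp_of_nat mult_1_left)
    then show ?thesis by (simp add: unit_exp_eq_cis s_def algebra_simps)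
  qed
  consider "n mod 3 = 1" | "n mod 3 = 2" using assms(1) by linarith
  then show ?thesis
  proof cases
    case 1
    then have "int n mod 3 = 1" by presburger
    moreover have "sin (2 * pi / 3 + s) \<ge> 1 / 2" using s by (intro sin_ge_half) linarith+
    ultimately show ?thesis using eq 1 by (simp add: chi3_def)
  next
    case 2
    then have "int n mod 3 = 2" by presburger
    \<comment> \<open>The half turn produces a minus sign that cancels the value -1 of
      \<open>chi3\<close>.\<close>
    moreover have "sin (2 * pi / 3 * 2 + s) = - sin (pi / 3 + s)"
    proof -
      have "2 * pi / 3 * 2 + s = (pi / 3 + s) + pi" by simp
      then show ?thesis by (simp only: sin_periodic_pi)
    qed
    moreover have "sin (pi / 3 + s) \<ge> 1 / 2" using s by (intro sin_ge_half) linarith+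
    ultimately show ?thesis using eq 2 by (simp add: chi3_def)
  qed
qed

definition chi3_prime_sum :: "nat \<Rightarrow> real \<Rightarrow> complex" where
  "chi3_prime_sum N x = (\<Sum>p | prime p \<and> p \<le> N. chi3 (int p) * unit_exp (real p * x))"

lemma norm_chi3_le_1: "norm (chi3 n) \<le> 1"
  by (simp add: chi3_def)

lemma continuous_on_chi3_prime_sum [continuous_intros]:
  "continuous_on S f \<Longrightarrow> continuous_on S (\<lambda>x. chi3_prime_sum N (f x))"
  unfolding chi3_prime_sum_def by (intro continuous_intros)

lemma chi3_prime_sum_periodic: "chi3_prime_sum N (x + 1) = chi3_prime_sum N x"
  by (simp add: chi3_prime_sum_def distrib_left unit_exp_add)

text \<open>Imaginary parts cannot cancel here: each prime other than 3 contributes at least 1/2,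
  and the prime 3 contributes 0.\<close>

lemma norm_chi3_prime_sum_third_ge:
  assumes "\<bar>y\<bar> \<le> 1 / (12 * real N)"
  shows "norm (chi3_prime_sum N (1 / 3 + y)) \<ge> real (card ({p. prime p \<and> p \<le> N} - {3})) / 2"
proof -
  let ?P = "{p. prime p \<and> p \<le> N}"
  have "real (card (?P - {3})) / 2 = (\<Sum>p\<in>?P - {3}. 1 / 2)" by simp
  also have "\<dots> \<le> (\<Sum>p\<in>?P - {3}. Im (chi3 (int p) * unit_exp (real p * (1 / 3 + y))))"
  proof (intro sum_mono Im_chi3_unit_exp_ge)
    fix p assume p: "p \<in> ?P - {3}"
    then have p': "prime p" "p \<le> N" "p \<noteq> 3" by auto
    have "\<not> 3 dvd p" using p' primes_dvd_imp_eq[of 3 p] by auto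
    then show "p mod 3 \<noteq> 0" by (simp add: dvd_eq_mod_eq_0)
    have "N > 0" using p' prime_gt_0_nat[of p] by linarith
    have "\<bar>real p * y\<bar> \<le> real N * (1 / (12 * real N))"
      unfolding abs_mult using p' assms by (intro mult_mono) auto
    then show "\<bar>real p * y\<bar> \<le> 1 / 12" using \<open>N > 0\<close> by simp
  qed
  also have "\<dots> = (\<Sum>p\<in>?P. Im (chi3 (int p) * unit_exp (real p * (1 / 3 + y))))"
    by (rule sum.mono_neutral_left) (auto simp: chi3_def)
  also have "\<dots> = Im (chi3_prime_sum N (1 / 3 + y))"
    by (simp add: chi3_prime_sum_def Im_sum)
  also have "\<dots> \<le> norm (chi3_prime_sum N (1 / 3 + y))"
    by (rule order_trans[OF abs_ge_self abs_Im_le_cmod])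
  finally show ?thesis .
qed

text \<open>Over all residues \<open>a\<close> the shifted sums add up to a multiple of a single
  term, since \<open>q\<close> is the only prime divisible by \<open>q\<close>; the total has norm
  at most \<open>q\<close>. Splitting off \<open>a = 0\<close> shows that a large value at
  \<open>x\<close> forces large values at the other shifts.\<close>

lemma norm_chi3_prime_sum_le_sum_fractions:
  assumes "prime q"
  shows "norm (chi3_prime_sum N x) - real q
    \<le> (\<Sum>a=1..<q. norm (chi3_prime_sum N (x + real a / real q)))"
proof -
  let ?P = "{p. prime p \<and> p \<le> N}"
  let ?c = "\<lambda>p. chi3 (int p) * unit_exp (real p * x)"
  have q: "q > 0" using assms by (simp add: prime_gt_0_nat)
  have "(\<Sum>a<q. chi3_prime_sum N (x + real a / real q))
    = (\<Sum>p\<in>?P. \<Sum>a<q. ?c p * unit_exp (real p * (real a / real q)))"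
    unfolding chi3_prime_sum_def
    by (subst sum.swap) (simp only: distrib_left unit_exp_add mult.assoc)
  also have "\<dots> = (\<Sum>p\<in>?P. ?c p * (if q dvd p then of_nat q else 0))"
    by (simp only: sum_distrib_left [symmetric] sum_unit_exp_fractions[OF q])
  also have "\<dots> = (\<Sum>p\<in>?P. if p = q then ?c q * of_nat q else 0)"
    by (rule sum.cong) (use assms primes_dvd_imp_eq in auto)
  also have "\<dots> = (if q \<le> N then ?c q * of_nat q else 0)"
    using assms by (simp add: sum.delta)
  finally have "norm (\<Sum>a<q. chi3_prime_sum N (x + real a / real q)) \<le> real q"
    using mult_right_mono[OF norm_chi3_le_1[of "int q"], of "real q"] by (simp add: norm_mult)
  moreover have "(\<Sum>a<q. chi3_prime_sum N (x + real a / real q))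
    = chi3_prime_sum N x + (\<Sum>a=1..<q. chi3_prime_sum N (x + real a / real q))"
    using q by (simp add: lessThan_atLeast0 sum.atLeast_Suc_lessThan)
  ultimately have "norm (chi3_prime_sum N x)
      - norm (\<Sum>a=1..<q. chi3_prime_sum N (x + real a / real q)) \<le> real q"
    using norm_diff_ineq[of "chi3_prime_sum N x"] by (metis order_trans)
  then show ?thesis
    using norm_sum[of "\<lambda>a. chi3_prime_sum N (x + real a / real q)" "{1..<q}"] by linarith
qed

text \<open>Each prime \<open>q \<le> Q\<close> has its own family of intervals of length
  \<open>1 / (6 * N)\<close> around \<open>1 / 3 + a / q\<close>. On this length the values of one
  family add up to at least half the count of primes other than 3, minus \<open>Q\<close>.\<close>

lemma integral_norm_chi3_prime_sum_ge:
  assumes "N > 0"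
  defines "Q \<equiv> sqrt (real N)"
  shows "real (card {q. prime q \<and> real q \<le> Q}) *
      ((real (card ({p. prime p \<and> p \<le> N} - {3})) / 2 - Q) * (1 / (6 * real N)))
    \<le> integral {0..1} (\<lambda>x. norm (chi3_prime_sum N x))"
proof -
  define P where "P = {q. prime q \<and> real q \<le> Q}"
  define d where "d = 1 / (12 * real N)"
  define M where "M = real (card ({p. prime p \<and> p \<le> N} - {3})) / 2"
  let ?g = "\<lambda>x. norm (chi3_prime_sum N (1 / 3 + x))"
  have "P \<subseteq> {..nat \<lfloor>Q\<rfloor>}" unfolding P_def by (auto simp: le_nat_floor)
  then have "finite P" by (rule finite_subset) simp
  \<comment> \<open>With \<open>Q\<^sup>2 = N\<close> the product is 1/6, so the choice of
    \<open>d\<close> from the bound near 1/3 also separates the intervals.\<close>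
  have d: "d \<ge> 0" "2 * d * Q\<^sup>2 < 1" unfolding d_def Q_def using assms by (auto simp: field_simps)
  have "real (card P) * ((M - Q) * (1 / (6 * real N))) = (\<Sum>q\<in>P. (M - Q) * (2 * d))"
    by (simp add: d_def)
  also have "\<dots> \<le> (\<Sum>q\<in>P. \<Sum>a=1..<q. integral {-d..d} (\<lambda>y. ?g (real a / real q + y)))"
  proof (rule sum_mono)
    fix q assume q: "q \<in> P"
    have "(M - Q) * (2 * d) = integral {-d..d} (\<lambda>y. M - Q)" using d by simp
    also have "\<dots> \<le> integral {-d..d} (\<lambda>y. \<Sum>a=1..<q. ?g (real a / real q + y))"
    proof (rule integral_le)
      show "(\<lambda>y. \<Sum>a=1..<q. ?g (real a / real q + y)) integrable_on {-d..d}"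
        by (intro integrable_continuous_real continuous_intros)
      fix y assume "y \<in> {-d..d}"
      then have "M \<le> ?g y"
        unfolding M_def by (intro norm_chi3_prime_sum_third_ge) (auto simp: d_def)
      moreover have "?g y - real q \<le> (\<Sum>a=1..<q. ?g (real a / real q + y))"
        using norm_chi3_prime_sum_le_sum_fractions[of q N "1 / 3 + y"] q
        by (simp add: P_def add_ac)
      ultimately show "M - Q \<le> (\<Sum>a=1..<q. ?g (real a / real q + y))"
        using q unfolding P_def by auto
    qed (rule integrable_const_ivl)
    also have "\<dots> = (\<Sum>a=1..<q. integral {-d..d} (\<lambda>y. ?g (real a / real q + y)))"
      by (intro integral_sum integrable_continuous_real continuous_intros) auto
    finally show "(M - Q) * (2 * d) \<le> \<dots>" .
  qed
  also have "\<dots> \<le> integral {0..1} ?g"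
    using \<open>finite P\<close> d unfolding P_def
    by (intro sum_integral_prime_fractions_le[where Q = Q] continuous_intros) auto
  \<comment> \<open>Periodicity removes the shift by 1/3 that centred the fractions at 0.\<close>
  also have "\<dots> = integral {0..1} (\<lambda>x. norm (chi3_prime_sum N x))"
    by (rule integral_periodic_shift) (auto intro!: continuous_intros simp: chi3_prime_sum_periodic)
  finally show ?thesis unfolding P_def M_def .
qed

section \<open>Positivity for every \<open>N\<close> and passage to a uniform constant\<close>

lemma integral_norm_chi3_prime_sum_pos:
  assumes "N \<ge> 2"
  shows "0 < integral {0..1} (\<lambda>x. norm (chi3_prime_sum N x))"
proof -
  let ?f = "\<lambda>x. norm (chi3_prime_sum N x)"
  \<comment> \<open>The prime 2 makes the bound at 1/3 positive, and a continuous nonnegative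
    function with zero integral would vanish there.\<close>
  have "2 \<in> {p. prime p \<and> p \<le> N} - {3::nat}" using assms by simp
  then have "card ({p. prime p \<and> p \<le> N} - {3}) > 0"
    by (subst card_gt_0_iff) (auto simp del: Diff_iff)
  moreover have "real (card ({p. prime p \<and> p \<le> N} - {3})) / 2 \<le> ?f (1 / 3 + 0)"
    by (rule norm_chi3_prime_sum_third_ge) simp
  ultimately have pos: "?f (1 / 3) > 0" by (simp del: zero_less_norm_iff)
  have cont: "continuous_on {0..1} ?f" by (intro continuous_intros)
  have "integral {0..1} ?f \<noteq> 0"
    using integral_eq_0_iff[OF cont] pos by fastforce
  moreover have "integral {0..1} ?f \<ge> 0" by (intro integral_nonneg integrable_continuous_real cont) simp
  ultimately show ?thesis by linarith
qed

lemma eventually_imp_uniform_lower_bound: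
  fixes F G :: "nat \<Rightarrow> real"
  assumes ev: "eventually (\<lambda>n. G n \<le> F n) sequentially"
    and pos: "\<And>n. n \<ge> m \<Longrightarrow> F n > 0" "\<And>n. n \<ge> m \<Longrightarrow> G n > 0"
  shows "\<exists>c>0. \<forall>n\<ge>m. F n \<ge> c * G n"
proof -
  obtain K where K: "\<And>n. n \<ge> K \<Longrightarrow> G n \<le> F n"
    using ev unfolding eventually_sequentially by blast
  \<comment> \<open>The entry 1 serves all \<open>n \<ge> K\<close>; the ratios serve the finitely
    many \<open>n\<close> below \<open>K\<close>.\<close>
  define A where "A = insert 1 ((\<lambda>n. F n / G n) ` {m..<K})"
  have "Min A > 0" unfolding A_def using pos by auto
  moreover have "F n \<ge> Min A * G n" if "n \<ge> m" for n
  proof -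
    have "Min A \<le> F n / G n"
    proof (cases "n \<ge> K")
      case True
      have "Min A \<le> 1" unfolding A_def by (intro Min_le) auto
      also have "1 \<le> F n / G n" using K[OF True] pos(2)[OF that] by simp
      finally show ?thesis .
    next
      case False
      then show ?thesis unfolding A_def using that by (intro Min_le) auto
    qed
    then show ?thesis using pos(2)[OF that] by (simp add: le_divide_eq)
  qed
  ultimately show ?thesis by blast
qed

lemma integral_norm_chi3_prime_sum_eventually_ge:
  "eventually (\<lambda>N. real N powr (1/4) / ln (real N)
     \<le> integral {0..1} (\<lambda>x. norm (chi3_prime_sum N x))) sequentially"
proof -
  \<comment> \<open>\<open>a\<close> is the Chebyshev bound for the primes up to
    \<open>sqrt x\<close>, where 2 replaces 1 to absorb rounding the root down; \<open>b\<close>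
    bounds half the number of primes up to \<open>x\<close> other than 3, minus
    \<open>sqrt x\<close>. Then \<open>a x * b x / (6 * x)\<close> has order
    \<open>sqrt x / (ln x)^2\<close>.\<close>
  define a where "a = (\<lambda>x::real. ((sqrt x - 2) * ln 2 - ln x) / ln x)"
  define b where "b = (\<lambda>x::real. (((x - 1) * ln 2 - ln x) / ln x - 1) / 2 - sqrt x)"
  have "eventually (\<lambda>x. x powr (1/4) / ln x \<le> a x * (b x * (1 / (6 * x)))) at_top"
    unfolding a_def b_def by real_asymp
  \<comment> \<open>The sign of \<open>b\<close> is what permits multiplying the two lower
    bounds.\<close>
  moreover have "eventually (\<lambda>x. b x \<ge> 0) at_top"
    unfolding b_def by real_asymp
  ultimately have "eventually (\<lambda>x. x powr (1/4) / ln x \<le> a x * (b x * (1 / (6 * x))) \<and> b x \<ge> 0) at_top"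
    by (rule eventually_conj)
  from eventually_compose_filterlim[OF this filterlim_real_sequentially]
  \<comment> \<open>From 4 on, the integer part of the root is at least 2, as the prime bound at
    \<open>m\<close> requires.\<close>
  show ?thesis using eventually_ge_at_top[of 4]
  proof eventually_elim
    case (elim N)
    define m where "m = nat \<lfloor>sqrt (real N)\<rfloor>"
    define P where "P = {p. prime p \<and> p \<le> N}"
    have ln_pos: "ln (real N) > 0" using elim by simp
    have "sqrt 4 \<le> sqrt (real N)" using elim by (intro real_sqrt_le_mono) simp
    then have N: "sqrt (real N) \<ge> 2" by simp
    have m: "m \<ge> 2" using N unfolding m_def by linarith
    have m_le: "real m \<le> sqrt (real N)" "sqrt (real N) \<le> real m + 1"
      using N unfolding m_def by linarith+
    have "sqrt (real N) * 1 \<le> sqrt (real N) * sqrt (real N)"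
    using N by (intro mult_left_mono) linarith+
    then have m_N: "real m \<le> real N" using m_le by simp
    have "(sqrt (real N) - 2) * ln 2 \<le> (real m - 1) * ln 2"
      by (rule mult_right_mono) (use m_le in auto)
    moreover have "ln (real m) \<le> ln (real N)" using m m_N by simp
    ultimately have "(sqrt (real N) - 2) * ln 2 - ln (real N) \<le> (real m - 1) * ln 2 - ln (real m)"
      by (rule diff_mono)
    also have "\<dots> \<le> real (card {q. prime q \<and> q \<le> m}) * ln (real m)"
      by (rule card_primes_ln_ge[OF m])
    also have "\<dots> \<le> real (card {q. prime q \<and> q \<le> m}) * ln (real N)"
      using m m_N by (intro mult_left_mono) auto
    finally have "a (real N) \<le> real (card {q. prime q \<and> q \<le> m})"
      unfolding a_def using ln_pos by (simp add: divide_le_eq)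
    moreover have "{q. prime q \<and> q \<le> m} = {q. prime q \<and> real q \<le> sqrt (real N)}"
      unfolding m_def using N by (auto simp: le_nat_iff le_floor_iff)
    ultimately have a_le: "a (real N) \<le> real (card {q. prime q \<and> real q \<le> sqrt (real N)})"
      by simp
    have "((real N - 1) * ln 2 - ln (real N)) / ln (real N) \<le> real (card P)"
      using card_primes_ln_ge[of N] elim ln_pos unfolding P_def by (simp add: divide_le_eq)
    moreover have "real (card P) - 1 \<le> real (card (P - {3}))"
      using diff_card_le_card_Diff[of "{3}" P] by simp
    ultimately have "((real N - 1) * ln 2 - ln (real N)) / ln (real N) - 1
        \<le> real (card (P - {3}))"
      by (rule order_trans[OF diff_right_mono])
    then have b_le: "b (real N) \<le> real (card (P - {3})) / 2 - sqrt (real N)"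
      unfolding b_def by (rule diff_right_mono[OF divide_right_mono]) simp
    have "real N powr (1/4) / ln (real N) \<le> a (real N) * (b (real N) * (1 / (6 * real N)))"
      using elim by simp
    also have "\<dots> \<le> real (card {q. prime q \<and> real q \<le> sqrt (real N)}) *
        ((real (card (P - {3})) / 2 - sqrt (real N)) * (1 / (6 * real N)))"
      using a_le b_le elim by (intro mult_mono mult_right_mono mult_nonneg_nonneg) auto
    also have "\<dots> \<le> integral {0..1} (\<lambda>x. norm (chi3_prime_sum N x))"
      unfolding P_def using elim by (intro integral_norm_chi3_prime_sum_ge) auto
    finally show ?case .
  qed
qed

theorem theorem9:
  shows "\<exists>c::real. c > 0 \<and>
    (\<forall>N::nat. N \<ge> 2 \<longrightarrow>
      integral {0..1} (\<lambda>\<alpha>::real.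
        norm (\<Sum>p | prime p \<and> p \<le> N. chi3 (int p) * unit_exp (real p * \<alpha>)))
      \<ge> c * (real N powr (1/4) / ln (real N)))"
  using eventually_imp_uniform_lower_bound[where m = 2,
      OF integral_norm_chi3_prime_sum_eventually_ge integral_norm_chi3_prime_sum_pos]
  unfolding chi3_prime_sum_def by simp

end
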